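(* Let $P=3\times5\times\dots\times331$ be the product of all odd primes $p$ with $3\le p\le 331$. For every odd integer $n>2P^2$, both $$\sigma(n)\le H_n+\exp(H_n)\log(H_n)\qquad\text{and}\qquad \sigma(n)<e^{\gamma}n\log\log n$$ hold.
   Context: $\sigma(n)=\sum_{d\mid n} d$ is the sum-of-divisors function, $H_n=\sum_{j=1}^n \frac1j$ is the $n$-th harmonic number, $\gamma$ is the Euler–Mascheroni constant, and $\log$ is the natural logarithm. The first inequality is the paper's "Lagarias criterion" for $n$, the second is "Robin's criterion" for $n$. *)

theory Defs
  imports "HOL-Analysis.Analysis" "HOL-Computational_Algebra.Primes"
begin

(* The set of divisors is infinite for n = 0, so divisor_sigma 0 = 0. *)
definition divisor_sigma :: "nat \<Rightarrow> nat" where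
  "divisor_sigma n = (\<Sum>d | d dvd n. d)"

definition odd_primorial_331 :: nat where
  "odd_primorial_331 = (\<Prod>p | prime p \<and> odd p \<and> 3 \<le> p \<and> p \<le> 331. p)"

definition lagarias_criterion :: "nat \<Rightarrow> bool" where
  "lagarias_criterion n \<longleftrightarrow>
     real (divisor_sigma n) \<le> harm n + exp (harm n) * ln (harm n)"

definition robin_criterion :: "nat \<Rightarrow> bool" where
  "robin_criterion n \<longleftrightarrow>
     real (divisor_sigma n) < exp euler_mascheroni * real n * ln (ln (real n))"

end

theory Submission
  imports Defs
begin

text \<open>Robin's inequality implies Lagarias's because \<^term>\<open>harm n \<ge> ln n + euler_mascheroni\<close>.
  For Robin's, \<open>\<sigma>(n)/n\<close> is at most the product of \<open>p/(p-1)\<close> over the primes dividing \<open>n\<close>. There are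
  few prime divisors above \<open>ln n\<close>, and the product over the odd primes up to \<open>x\<close> is about
  \<open>(e\<^sup>\<gamma>/2) ln x\<close>. For odd \<open>n\<close> the missing factor at 2 thus leaves a slack of a factor 2, so crude
  versions of the theorems of Chebyshev (\<open>\<Prod>p \<le> 4\<^sup>n\<close>) and Mertens, anchored at an
  explicit computation with the primes up to 64, suffice.\<close>

section \<open>Chebyshev's upper bound for the product of the primes\<close>

lemma prod_dvd_of_pairwise_coprime:
  fixes f :: "'a \<Rightarrow> nat"
  assumes "finite A" "\<And>x. x \<in> A \<Longrightarrow> f x dvd n"
    and "\<And>x y. x \<in> A \<Longrightarrow> y \<in> A \<Longrightarrow> x \<noteq> y \<Longrightarrow> coprime (f x) (f y)"
  shows "(\<Prod>x\<in>A. f x) dvd n"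
  using assms
proof (induction A rule: finite_induct)
  case (insert x A)
  have "coprime (f x) (\<Prod>y\<in>A. f y)"
    using insert by (intro prod_coprime_right) auto
  with insert show ?case by (simp add: divides_mult)
qed simp

lemma finite_primes_le: "finite {p::nat. prime p \<and> p \<le> n}"
  by (rule finite_subset[of _ "{..n}"]) auto

lemma primes_le_Suc:
  "{p. prime p \<and> p \<le> Suc n} = (if prime (Suc n) then insert (Suc n) {p. prime p \<and> p \<le> n}
     else {p. prime p \<and> p \<le> n})"
  by (auto simp: le_Suc_eq)

text \<open>The two equal middle coefficients both occur in a row with sum
  \<open>2 ^ (2 * m + 1)\<close>, so each is at most half of it.\<close>

lemma binomial_odd_middle_le: "(2 * m + 1) choose m \<le> 4 ^ m"
proof -
  have "(\<Sum>k\<in>{m, m + 1}. (2 * m + 1) choose k) \<le> (\<Sum>k\<le>2 * m + 1. (2 * m + 1) choose k)"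
    by (rule sum_mono2) auto
  moreover have "(2 * m + 1) choose (m + 1) = (2 * m + 1) choose m"
    using binomial_symmetric[of m "2 * m + 1"] by simp
  ultimately have "2 * ((2 * m + 1) choose m) \<le> 2 ^ (2 * m + 1)"
    using choose_row_sum[of "2 * m + 1"] by simp
  then show ?thesis by (simp add: power_mult)
qed

text \<open>Erdos's argument. An even \<open>n > 2\<close> adds no prime. For
  \<open>n = 2 * m + 1\<close>, the primes in \<open>(m + 1, n]\<close> divide \<open>fact n\<close>
  but neither \<open>fact m\<close> nor \<open>fact (m + 1)\<close>, hence they divide
  \<open>n choose m\<close>, which is at most \<open>4 ^ m\<close>; induction handles the primes up
  to \<open>m + 1\<close>.\<close>

lemma primorial_le: "(\<Prod>p | prime p \<and> p \<le> n. p) \<le> (4::nat) ^ n"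
proof (induction n rule: less_induct)
  case (less n)
  consider "n \<le> 1" | "n = 2" | "n > 2" "even n" | m where "n = 2 * m + 1" "m \<ge> 1"
  proof -
    have "n \<le> 1 \<or> n = 2 \<or> n > 2 \<and> even n \<or> (\<exists>m\<ge>1. n = 2 * m + 1)" by presburger
    then show thesis using that by blast
  qed
  then show ?case
  proof cases
    case 1
    then have "{p. prime p \<and> p \<le> n} = {}" by (auto dest!: prime_gt_1_nat)
    then show ?thesis by (simp only: prod.empty) simp
  next
    case 2
    then have "{p. prime p \<and> p \<le> n} = {2}" using prime_ge_2_nat by (auto intro: antisym)
    then show ?thesis using 2 by simp
  next
    case 3
    then obtain k where k: "n = Suc k" by (metis less_imp_Suc_add)
    have "\<not> prime n" using 3 prime_odd_nat by blast
    then have "{p. prime p \<and> p \<le> n} = {p. prime p \<and> p \<le> k}"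
      using primes_le_Suc[of k] k by simp
    moreover have "(\<Prod>p | prime p \<and> p \<le> k. p) \<le> (4::nat) ^ k" using less k by simp
    moreover have "(4::nat) ^ k \<le> 4 ^ n" using k by simp
    ultimately show ?thesis by (simp only: le_trans)
  next
    case 4
    define A B where "A = {p::nat. prime p \<and> p \<le> m + 1}"
      and "B = {p::nat. prime p \<and> m + 1 < p \<and> p \<le> n}"
    have fin: "finite A" "finite B"
      unfolding A_def B_def by (rule finite_subset[of _ "{..m + 1 + n}"]; force)+
    have "{p. prime p \<and> p \<le> n} = A \<union> B" "A \<inter> B = {}"
      using 4 by (auto simp: A_def B_def)
    then have split: "(\<Prod>p | prime p \<and> p \<le> n. p) = \<Prod>A * \<Prod>B"
      using fin by (simp add: prod.union_disjoint)
    have "\<Prod>B dvd n choose m"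
    proof (rule prod_dvd_of_pairwise_coprime)
      fix p assume p: "p \<in> B"
      have "p dvd fact n" using p by (auto simp: B_def prime_dvd_fact_iff)
      moreover have "fact m * fact (m + 1) * (n choose m) = (fact n :: nat)"
        using binomial_fact_lemma[of m n] 4 by simp
      moreover have "\<not> p dvd fact m" "\<not> p dvd fact (m + 1)"
        using p prime_dvd_fact_iff[of p m] prime_dvd_fact_iff[of p "m + 1"] by (auto simp: B_def)
      ultimately show "p dvd n choose m" using p prime_dvd_mult_iff[of p] by (metis B_def mem_Collect_eq)
    qed (use fin in \<open>auto simp: B_def primes_coprime\<close>)
    then have "\<Prod>B \<le> 4 ^ m"
      using binomial_odd_middle_le[of m] 4 by (metis dvd_imp_le le_trans zero_less_binomial_iff
          le_add1 mult_2 add.assoc)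
    moreover have "\<Prod>A \<le> 4 ^ (m + 1)" using less[of "m + 1"] 4 by (simp add: A_def)
    ultimately have "\<Prod>A * \<Prod>B \<le> 4 ^ (m + 1) * 4 ^ m" by (rule mult_le_mono[rotated])
    also have "\<dots> = 4 ^ n" using 4 by (simp add: power_add[symmetric])
    finally show ?thesis using split by simp
  qed
qed

lemma sum_ln_primes_le: "(\<Sum>p | prime p \<and> p \<le> n. ln (real p)) \<le> real n * ln 4"
proof -
  have "(\<Sum>p | prime p \<and> p \<le> n. ln (real p)) = ln (\<Prod>p | prime p \<and> p \<le> n. real p)"
    by (intro ln_prod[symmetric]) (use prime_gt_0_nat in \<open>auto simp: finite_primes_le\<close>)
  also have "\<dots> = ln (real (\<Prod>p | prime p \<and> p \<le> n. p))" by simp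
  also have "\<dots> \<le> ln (real (4 ^ n))"
  proof -
    have "(\<Prod>p | prime p \<and> p \<le> n. p) > 0" by (intro prod_pos) (auto simp: prime_gt_0_nat)
    then show ?thesis using primorial_le[of n] by (subst ln_le_cancel_iff) (auto simp del: of_nat_prod of_nat_power)
  qed
  finally show ?thesis by (simp add: ln_realpow)
qed

section \<open>Upper half of Mertens' first theorem\<close>

text \<open>Weak Stirling bound, \<open>n!\<close> at most \<open>e * n * (n / e) ^ n\<close>. The
  induction step amounts to \<open>ln (1 + 1 / n) \<ge> 1 / (n + 1)\<close>.\<close>

lemma ln_fact_le:
  assumes "n \<ge> 1"
  shows "ln (fact n) \<le> 1 + ln (real n) + real n * ln (real n) - real n"
  using assms
proof (induction n rule: dec_induct)
  case (step n)
  have "ln (real n / real (n + 1)) \<le> real n / real (n + 1) - 1"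
    using step by (intro ln_le_minus_one) simp
  then have "1 / real (n + 1) \<le> ln (real (n + 1)) - ln (real n)"
    using step by (simp add: ln_div field_simps)
  then have "1 \<le> (real n + 1) * (ln (real (n + 1)) - ln (real n))"
    by (simp add: field_simps)
  moreover have "ln (fact (Suc n)) = ln (real (n + 1)) + ln (fact n :: real)"
    using step by (simp add: ln_mult)
  ultimately show ?case using step by (simp add: algebra_simps)
qed simp

lemma prime_power_dvd_fact: "p ^ k dvd (fact (p * k) :: nat)" if "p > 0"
proof (induction k)
  case (Suc k)
  have "fact (p * k) * (p * Suc k) dvd (fact (p * Suc k) :: nat)"
  proof -
    obtain q where q: "p * Suc k = Suc q" using \<open>p > 0\<close> by (metis mult_is_0 nat.simps(3) not0_implies_Suc not_gr_zero)
    have "p * k \<le> q" using q \<open>p > 0\<close> by (simp add: algebra_simps)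
    then have "fact (p * k) dvd (fact q :: nat)" by (rule fact_dvd)
    then show ?thesis by (simp only: q fact_Suc of_nat_id mult.commute[of "Suc q"] mult_dvd_mono dvd_refl)
  qed
  moreover have "p ^ Suc k dvd fact (p * k) * (p * Suc k)"
    using Suc by (simp add: mult_dvd_mono mult.commute del: mult_Suc_right)
  ultimately show ?case by (rule dvd_trans[rotated])
qed simp

text \<open>One-sided form of Legendre's formula: of the exponent of \<open>p\<close> in
  \<open>fact n\<close> only the leading term \<open>n div p\<close> is kept.\<close>

lemma sum_ln_primes_div_le_ln_fact:
  "(\<Sum>p | prime p \<and> p \<le> n. real (n div p) * ln (real p)) \<le> ln (fact n)"
proof -
  have dvd: "(\<Prod>p | prime p \<and> p \<le> n. p ^ (n div p)) dvd (fact n :: nat)"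
  proof (rule prod_dvd_of_pairwise_coprime)
    fix p assume "p \<in> {p. prime p \<and> p \<le> n}"
    then have "p ^ (n div p) dvd (fact (p * (n div p)) :: nat)"
      by (intro prime_power_dvd_fact) (auto simp: prime_gt_0_nat)
    also have "\<dots> dvd fact n" by (intro fact_dvd) simp
    finally show "p ^ (n div p) dvd fact n" .
  qed (auto simp: finite_primes_le primes_coprime)
  have pos: "(\<Prod>p | prime p \<and> p \<le> n. p ^ (n div p)) > 0"
    by (intro prod_pos) (auto simp: prime_gt_0_nat)
  have "(\<Sum>p | prime p \<and> p \<le> n. real (n div p) * ln (real p))
      = (\<Sum>p | prime p \<and> p \<le> n. ln (real p ^ (n div p)))"
    by (intro sum.cong) (auto simp: ln_realpow prime_gt_0_nat)
  also have "\<dots> = ln (\<Prod>p | prime p \<and> p \<le> n. real p ^ (n div p))"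
    by (intro ln_prod[symmetric]) (auto simp: finite_primes_le prime_gt_0_nat)
  also have "\<dots> = ln (real (\<Prod>p | prime p \<and> p \<le> n. p ^ (n div p)))" by simp
  also have "\<dots> \<le> ln (real (fact n))"
    using pos dvd_imp_le[OF dvd] by (subst ln_le_cancel_iff) (auto simp del: of_nat_prod of_nat_power of_nat_fact)
  finally show ?thesis by simp
qed

definition mertens_sum :: "nat \<Rightarrow> real" where
  "mertens_sum n = (\<Sum>p | prime p \<and> p \<le> n. ln (real p) / real p)"

lemma mertens_sum_le:
  assumes "n \<ge> 1"
  shows "mertens_sum n \<le> ln (real n) + ln 4 - 1 + (1 + ln (real n)) / real n"
proof -
  \<comment> \<open>The subtracted sum turns \<open>n / p\<close> into \<open>n / p - 1\<close>,
    which is below \<open>n div p\<close>; this loss is later paid for by Chebyshev's bound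
    \<open>n * ln 4\<close>.\<close>
  have "real n * mertens_sum n - (\<Sum>p | prime p \<and> p \<le> n. ln (real p))
      = (\<Sum>p | prime p \<and> p \<le> n. (real n / real p - 1) * ln (real p))"
    by (simp add: mertens_sum_def sum_distrib_left sum_subtractf[symmetric] field_simps)
  also have "\<dots> \<le> (\<Sum>p | prime p \<and> p \<le> n. real (n div p) * ln (real p))"
  proof (intro sum_mono mult_right_mono)
    fix p assume "p \<in> {p. prime p \<and> p \<le> n}"
    then have "p > 0" "prime p" by (auto simp: prime_gt_0_nat)
    have "real n / real p \<le> real (n div p) + 1"
      using floor_divide_of_nat_eq[of n p, where ?'a = real] by linarith
    then show "real n / real p - 1 \<le> real (n div p)" by simp
    show "ln (real p) \<ge> 0" using \<open>p > 0\<close> by simp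
  qed
  also have "\<dots> \<le> 1 + ln (real n) + real n * ln (real n) - real n"
    using sum_ln_primes_div_le_ln_fact[of n] ln_fact_le[OF assms] by linarith
  finally have "real n * mertens_sum n \<le> real n * (ln (real n) + ln 4 - 1) + (1 + ln (real n))"
    using sum_ln_primes_le[of n] by (simp add: algebra_simps)
  then show ?thesis using assms by (simp add: field_simps)
qed

lemma ln_2_ge: "ln (2::real) \<ge> 307 / 443"
  using ln_approx_bounds[of 2 3] by (simp add: eval_nat_numeral)

lemma ln_64: "ln (64::real) = 6 * ln 2"
  using ln_realpow[of 2 6] by simp

text \<open>The tangent to \<open>ln\<close> at 64 bounds the error term
  \<open>(1 + ln n) / n\<close> by \<open>1 / 9\<close>; with \<open>ln 4 \<le> 25 / 18\<close> the
  constant becomes exactly \<open>25 / 18 - 1 + 1 / 9 = 1 / 2\<close>.\<close>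

lemma mertens_sum_le_half:
  assumes "n \<ge> 64"
  shows "mertens_sum n \<le> ln (real n) + 1 / 2"
proof -
  have "ln (real n / 64) \<le> real n / 64 - 1" using assms by (intro ln_le_minus_one) simp
  then have "ln (real n) \<le> 6 * ln 2 + real n / 64 - 1" using assms by (simp add: ln_div ln_64)
  then have "1 + ln (real n) \<le> 25 / 6 + real n / 64" using ln2_le_25_over_36 by simp
  also have "\<dots> \<le> real n * (1 / 9)" using assms by simp
  finally have "(1 + ln (real n)) / real n \<le> 1 / 9" using assms by (simp add: field_simps)
  moreover have "ln (4::real) \<le> 25 / 18" using ln_realpow[of 2 2] ln2_le_25_over_36 by simp
  ultimately show ?thesis using mertens_sum_le[of n] assms by linarith
qed


section \<open>Mertens-type bound for the Euler product over odd primes\<close>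

definition ln_euler_prod_odd :: "nat \<Rightarrow> real" where
  "ln_euler_prod_odd n = (\<Sum>p | prime p \<and> odd p \<and> p \<le> n. ln (real p / (real p - 1)))"

lemma finite_odd_primes_le: "finite {p::nat. prime p \<and> odd p \<and> p \<le> n}"
  by (rule finite_subset[of _ "{..n}"]) auto

lemma mertens_sum_Suc:
  "mertens_sum (Suc n) = mertens_sum n + (if prime (Suc n) then ln (real (Suc n)) / real (Suc n) else 0)"
  by (simp add: mertens_sum_def primes_le_Suc finite_primes_le)

lemma ln_euler_prod_odd_Suc:
  assumes "n \<ge> 2"
  shows "ln_euler_prod_odd (Suc n)
    = ln_euler_prod_odd n + (if prime (Suc n) then ln (real (Suc n) / real n) else 0)"
proof -
  have "{p. prime p \<and> odd p \<and> p \<le> Suc n} = (if prime (Suc n)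
      then insert (Suc n) {p. prime p \<and> odd p \<and> p \<le> n} else {p. prime p \<and> odd p \<and> p \<le> n})"
    using assms prime_odd_nat[of "Suc n"] by (auto simp: le_Suc_eq)
  then show ?thesis by (simp add: ln_euler_prod_odd_def finite_odd_primes_le)
qed

text \<open>Discrete partial summation: \<^term>\<open>mertens_sum n / ln n\<close> carries the boundary term,
  and \<^term>\<open>1 / real n\<close> absorbs the difference between \<^term>\<open>ln (p / (p - 1))\<close> and
  \<^term>\<open>1 / p\<close>.\<close>

definition mertens_defect :: "nat \<Rightarrow> real" where
  "mertens_defect n = ln_euler_prod_odd n - (mertens_sum n - 1 / 2) / ln (real n)
     - ln (ln (real n)) + 1 / real n"

text \<open>Changing the denominator from \<open>ln n\<close> to \<open>ln (n + 1)\<close> costs at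
  most the growth of \<open>ln (ln n)\<close>, because
  \<open>mertens_sum n - 1 / 2 \<le> ln n\<close>. If \<open>n + 1\<close> is prime, the Euler
  product gains at most \<open>1 / n\<close> and the boundary term gains \<open>1 / (n + 1)\<close>;
  the excess is the decrease of the summand \<open>1 / n\<close>.\<close>

lemma mertens_defect_Suc_le:
  assumes "n \<ge> 64"
  shows "mertens_defect (Suc n) \<le> mertens_defect n"
proof -
  define a b x where "a = ln (real n)" and "b = ln (real (Suc n))" and "x = mertens_sum n - 1 / 2"
  have ab: "0 < a" "a < b" using assms by (simp_all add: a_def b_def)
  have xa: "x \<le> a" using mertens_sum_le_half[OF assms] by (simp add: x_def a_def)
  have "x * (1 / a - 1 / b) \<le> a * (1 / a - 1 / b)"
    using xa ab by (intro mult_right_mono) (simp_all add: field_simps)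
  also have "\<dots> = 1 - a / b" using ab by (simp add: field_simps)
  also have "\<dots> \<le> ln b - ln a"
    using ln_le_minus_one[of "a / b"] ab by (simp add: ln_div)
  finally have main: "x / a - x / b \<le> ln b - ln a" by (simp add: algebra_simps)
  show ?thesis
  proof (cases "prime (Suc n)")
    case False
    have "1 / real (Suc n) \<le> 1 / real n" using assms by (simp add: field_simps)
    moreover have "ln_euler_prod_odd (Suc n) = ln_euler_prod_odd n" "mertens_sum (Suc n) = mertens_sum n"
      using False assms by (simp_all add: ln_euler_prod_odd_Suc mertens_sum_Suc)
    ultimately show ?thesis using main
      unfolding mertens_defect_def a_def[symmetric] b_def[symmetric] x_def[symmetric]
      by (simp only: x_def[symmetric])
  next
    case True
    have "ln (real (Suc n) / real n) \<le> real (Suc n) / real n - 1"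
      using assms by (intro ln_le_minus_one) simp
    also have "\<dots> = 1 / real n" using assms by (simp add: field_simps)
    finally have step: "ln (real (Suc n) / real n) \<le> 1 / real n" .
    have "(mertens_sum (Suc n) - 1 / 2) / b = x / b + 1 / real (Suc n)"
      using True ab by (simp add: mertens_sum_Suc x_def add_divide_distrib diff_divide_distrib
          del: of_nat_Suc flip: b_def)
    moreover have "ln_euler_prod_odd (Suc n) = ln_euler_prod_odd n + ln (real (Suc n) / real n)"
      using True assms by (simp add: ln_euler_prod_odd_Suc)
    ultimately show ?thesis using main step
      unfolding mertens_defect_def a_def[symmetric] b_def[symmetric] x_def[symmetric] by linarith
  qed
qed

lemma odd_primes_le_64: "{p::nat. prime p \<and> odd p \<and> p \<le> 64}
    = {3, 5, 7, 11, 13, 17, 19, 23, 29, 31, 37, 41, 43, 47, 53, 59, 61}"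
proof -
  have "{p::nat. prime p \<and> odd p \<and> p \<le> 64} = {p \<in> {2..<65}. prime p \<and> odd p}"
    by (auto dest: prime_ge_2_nat)
  also have "\<dots> = set (filter (\<lambda>p. prime p \<and> odd p) [2..<65])"
    by (simp only: set_filter set_upt)
  also have "\<dots> = {3, 5, 7, 11, 13, 17, 19, 23, 29, 31, 37, 41, 43, 47, 53, 59, 61}"
    by (simp add: upt_rec_numeral del: set_filter)
  finally show ?thesis .
qed

lemma ln_euler_prod_odd_64_le: "ln_euler_prod_odd 64 \<le> ln (ln 64) - 8 / 100"
proof -
  have "ln_euler_prod_odd 64 = ln (\<Prod>p | prime p \<and> odd p \<and> p \<le> (64::nat). real p / (real p - 1))"
    unfolding ln_euler_prod_odd_def
    by (intro ln_prod[symmetric] finite_odd_primes_le) (use prime_gt_1_nat in fastforce)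
  \<comment> \<open>The product over the 17 listed primes is evaluated exactly; 3.8 is a convenient
    rational above it.\<close>
  also have "\<dots> \<le> ln (38 / 10)"
    unfolding odd_primes_le_64 by (simp add: field_simps)
  also have "\<dots> = ln (ln 64) + ln (38 / 10 / ln 64)"
    by (subst ln_mult_pos[symmetric]) simp_all
  also have "ln (38 / 10 / ln (64::real)) \<le> 38 / 10 / ln 64 - 1"
    by (intro ln_le_minus_one) simp
  also have "38 / 10 / ln (64::real) \<le> 92 / 100"
    using ln_2_ge by (simp add: ln_64 field_simps)
  finally show ?thesis by simp
qed

text \<open>Certifies binary logarithms to within quarters by comparing integers only.\<close>

lemma ln_ge_quarter:
  assumes "2 ^ j \<le> p ^ 4" "p > 0"
  shows "ln (real p) / real p \<ge> (real j / (4 * real p)) * ln 2"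
proof -
  have "ln (real (2 ^ j)) \<le> ln (real (p ^ 4))"
    using assms by (subst ln_le_cancel_iff) (simp_all only: of_nat_le_iff of_nat_0_less_iff zero_less_power
      zero_less_numeral)
  then have "real j * ln 2 \<le> 4 * ln (real p)" using assms by (simp add: ln_realpow)
  then show ?thesis using assms by (simp add: field_simps)
qed

lemma mertens_sum_64_ge: "mertens_sum 64 \<ge> 69 / 100 * ln 64"
proof -
  \<comment> \<open>pairs \<open>(p, j)\<close> with \<open>j = \<lfloor>4 log\<^sub>2 p\<rfloor>\<close>\<close>
  define qs :: "(nat \<times> nat) list" where "qs = [(2, 4), (3, 6), (5, 9), (7, 11), (11, 13), (13, 14),
    (17, 16), (19, 16), (23, 18), (29, 19), (31, 19), (37, 20), (41, 21), (43, 21), (47, 22),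
    (53, 22), (59, 23), (61, 23)]"
  have all: "list_all (\<lambda>(p, j). prime p \<and> p \<le> 64 \<and> 0 < p \<and> 2 ^ j \<le> p ^ 4) qs"
    by (simp add: qs_def)
  have "distinct (map fst qs)" by (simp add: qs_def)
  \<comment> \<open>In units of \<open>ln 2\<close>, where \<open>ln 64\<close> is 6, only a
    rational inequality has to be computed.\<close>
  have "69 / 100 * 6 \<le> (\<Sum>(p, j)\<leftarrow>qs. real j / (4 * real p))" by (simp add: qs_def)
  then have "69 / 100 * 6 * ln 2 \<le> (\<Sum>(p, j)\<leftarrow>qs. real j / (4 * real p)) * ln 2"
    by (intro mult_right_mono) simp_all
  then have "69 / 100 * ln 64 \<le> (\<Sum>(p, j)\<leftarrow>qs. real j / (4 * real p)) * ln 2"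
    by (simp add: ln_64)
  also have "\<dots> = (\<Sum>(p, j)\<leftarrow>qs. real j / (4 * real p) * ln 2)"
    by (simp add: sum_list_mult_const[symmetric] case_prod_unfold)
  also have "\<dots> \<le> (\<Sum>(p, j)\<leftarrow>qs. ln (real p) / real p)"
    using all ln_ge_quarter by (intro sum_list_mono) (auto simp: list_all_iff)
  also have "\<dots> = sum_list (map (\<lambda>p. ln (real p) / real p) (map fst qs))"
    by (simp add: case_prod_unfold comp_def)
  also have "\<dots> = (\<Sum>p\<in>set (map fst qs). ln (real p) / real p)"
    by (rule sum.distinct_set_conv_list[OF \<open>distinct (map fst qs)\<close>, symmetric])
  also have "\<dots> \<le> mertens_sum 64"
    unfolding mertens_sum_def
  proof (rule sum_mono2[OF finite_primes_le])
    show "set (map fst qs) \<subseteq> {p. prime p \<and> p \<le> 64}"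
      using all by (auto simp: list_all_iff)
    show "0 \<le> ln (real p) / real p" if "p \<in> {p. prime p \<and> p \<le> 64} - set (map fst qs)" for p
      using that prime_gt_0_nat[of p] by simp
  qed
  finally show ?thesis .
qed

text \<open>The terms \<open>ln (ln 64)\<close> cancel, leaving
  \<open>- 0.08 - 0.69 + 1 / 8 + 1 / 64 < - 0.6\<close>.\<close>

lemma mertens_defect_64_le: "mertens_defect 64 \<le> - 3 / 5"
proof -
  have "ln (64::real) > 0" "ln (64::real) \<ge> 4.15" using ln_2_ge by (simp_all add: ln_64)
  then have "(1 / 2) / ln (64::real) \<le> 1 / 8" by (simp add: field_simps)
  moreover have "mertens_sum 64 / ln 64 \<ge> 69 / 100"
    using mertens_sum_64_ge by (simp add: field_simps)
  ultimately show ?thesis using ln_euler_prod_odd_64_le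
    unfolding mertens_defect_def diff_divide_distrib of_nat_numeral by linarith
qed

text \<open>The defect stays below its value at 64, and the boundary term is at most 1, so the
  constant is \<open>1 - 3 / 5\<close>. The true limiting constant is
  \<open>euler_mascheroni - ln 2\<close>, about -0.12, so there is ample room.\<close>

lemma ln_euler_prod_odd_le:
  assumes "n \<ge> 64"
  shows "ln_euler_prod_odd n \<le> ln (ln (real n)) + 2 / 5"
proof -
  have "mertens_defect n \<le> mertens_defect 64"
    using assms by (induction n rule: dec_induct) (auto intro: order_trans[OF mertens_defect_Suc_le])
  then have "mertens_defect n \<le> - 3 / 5" using mertens_defect_64_le by linarith
  moreover have "(mertens_sum n - 1 / 2) / ln (real n) \<le> 1"
    using mertens_sum_le_half[OF assms] assms by (simp add: divide_le_eq)
  moreover have "1 / real n \<ge> 0" by simp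
  ultimately show ?thesis unfolding mertens_defect_def by linarith
qed


section \<open>Bounding the divisor sum by an Euler product\<close>

text \<open>Multiplication maps pairs of divisors of \<open>a\<close> and \<open>b\<close> onto the
  divisors of \<open>a * b\<close>. It may fail to be injective, hence an inequality.\<close>

lemma divisor_sigma_mult_le:
  assumes "a > 0" "b > 0"
  shows "divisor_sigma (a * b) \<le> divisor_sigma a * divisor_sigma b"
proof -
  have "divisor_sigma (a * b) \<le> sum id ((\<lambda>(x, y). x * y) ` ({d. d dvd a} \<times> {d. d dvd b}))"
    unfolding divisor_sigma_def id_def
  proof (intro sum_mono2)
    show "{d. d dvd a * b} \<subseteq> (\<lambda>(x, y). x * y) ` ({d. d dvd a} \<times> {d. d dvd b})"
      by (force elim: dvd_productE)
  qed (use assms in auto)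
  also have "\<dots> \<le> sum (id \<circ> (\<lambda>(x, y). x * y)) ({d. d dvd a} \<times> {d. d dvd b})"
    using assms by (intro sum_image_le) auto
  also have "\<dots> = divisor_sigma a * divisor_sigma b"
    by (simp add: divisor_sigma_def sum_product sum.cartesian_product case_prod_unfold)
  finally show ?thesis .
qed

lemma divisor_sigma_prod_le:
  assumes "finite A" "\<And>x. x \<in> A \<Longrightarrow> f x > 0"
  shows "divisor_sigma (\<Prod>x\<in>A. f x) \<le> (\<Prod>x\<in>A. divisor_sigma (f x))"
  using assms
proof (induction A rule: finite_induct)
  case empty
  then show ?case by (simp add: divisor_sigma_def)
next
  case (insert x A)
  then have "divisor_sigma (f x * prod f A) \<le> divisor_sigma (f x) * divisor_sigma (prod f A)"
    by (intro divisor_sigma_mult_le prod_pos) auto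
  also have "\<dots> \<le> divisor_sigma (f x) * (\<Prod>x\<in>A. divisor_sigma (f x))"
    using insert by simp
  finally show ?case using insert by simp
qed

text \<open>Dropping the \<open>- 1\<close> in the numerator of the geometric sum makes the factor
  independent of \<open>k\<close>.\<close>

lemma divisor_sigma_prime_power_le:
  assumes "prime p"
  shows "real (divisor_sigma (p ^ k)) \<le> real (p ^ k) * (real p / (real p - 1))"
proof -
  have p: "p > 1" using assms by (rule prime_gt_1_nat)
  have "{d. d dvd p ^ k} = (\<lambda>i. p ^ i) ` {..k}"
    using divides_primepow_nat[OF assms] by auto
  moreover have "inj_on (\<lambda>i. p ^ i) {..k}" using p by (auto simp: inj_on_def)
  ultimately have "real (divisor_sigma (p ^ k)) = (\<Sum>i\<le>k. real p ^ i)"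
    by (simp add: divisor_sigma_def sum.reindex)
  also have "\<dots> = (real p ^ Suc k - 1) / (real p - 1)"
    using p geometric_sum[of "real p" "Suc k"] by (simp add: lessThan_Suc_atMost)
  also have "\<dots> \<le> real p ^ Suc k / (real p - 1)"
    using p by (intro divide_right_mono) auto
  finally show ?thesis by (simp add: mult.commute)
qed

lemma divisor_sigma_le:
  assumes "n > 0"
  shows "real (divisor_sigma n) \<le> real n * (\<Prod>p\<in>prime_factors n. real p / (real p - 1))"
proof -
  have n: "n = (\<Prod>p\<in>prime_factors n. p ^ multiplicity p n)"
    using assms by (simp add: prime_factorization_nat)
  have "divisor_sigma n \<le> (\<Prod>p\<in>prime_factors n. divisor_sigma (p ^ multiplicity p n))"
    by (subst n, rule divisor_sigma_prod_le) (auto simp: prime_factors_gt_0_nat)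
  then have "real (divisor_sigma n) \<le> (\<Prod>p\<in>prime_factors n. real (divisor_sigma (p ^ multiplicity p n)))"
    by (simp only: of_nat_prod[symmetric] of_nat_le_iff)
  also have "\<dots> \<le> (\<Prod>p\<in>prime_factors n. real (p ^ multiplicity p n) * (real p / (real p - 1)))"
    by (intro prod_mono conjI divisor_sigma_prime_power_le) auto
  also have "\<dots> = (\<Prod>p\<in>prime_factors n. real (p ^ multiplicity p n))
      * (\<Prod>p\<in>prime_factors n. real p / (real p - 1))"
    by (rule prod.distrib)
  also have "(\<Prod>p\<in>prime_factors n. real (p ^ multiplicity p n)) = real n"
    by (subst (3) n) simp
  finally show ?thesis .
qed

section \<open>Robin's inequality for large odd numbers\<close>

lemma sum_ln_prime_factors_le:
  assumes "n > 0"
  shows "(\<Sum>p\<in>prime_factors n. ln (real p)) \<le> ln (real n)"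
proof -
  have "\<Prod>(prime_factors n) dvd n"
    by (rule prod_dvd_of_pairwise_coprime) (auto simp: in_prime_factors_iff primes_coprime)
  then have "\<Prod>(prime_factors n) \<le> n" using assms by (simp add: dvd_imp_le)
  then have "real (\<Prod>(prime_factors n)) \<le> real n" by (simp only: of_nat_le_iff)
  moreover have "real (\<Prod>(prime_factors n)) > 0"
    using prime_factors_gt_0_nat by (simp only: of_nat_0_less_iff) (rule prod_pos, auto)
  moreover have "(\<Sum>p\<in>prime_factors n. ln (real p)) = ln (real (\<Prod>(prime_factors n)))"
    by (simp add: ln_prod prime_factors_gt_0_nat)
  ultimately show ?thesis by simp
qed

text \<open>Prime factors below \<^term>\<open>ln n\<close> are controlled by the Mertens-type bound; there are at most
  \<^term>\<open>ln n / ln (ln n)\<close> larger ones, each contributing at most \<^term>\<open>1 / real N\<close>.\<close>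

lemma sum_ln_prime_factors_euler_le:
  fixes n :: nat
  assumes "odd n" "ln (real n) \<ge> 500"
  shows "(\<Sum>p\<in>prime_factors n. ln (real p / (real p - 1))) \<le> ln (ln (ln (real n))) + 57 / 100"
proof -
  define L where "L = ln (real n)"
  define N where "N = nat \<lfloor>L\<rfloor>"
  have L: "L \<ge> 500" using assms by (simp add: L_def)
  have N: "real N \<le> L" "L < real N + 1" "N \<ge> 500" using L by (auto simp: N_def) linarith+
  have n: "n > 0" using assms(1) by (rule odd_pos)
  define S B where "S = {p \<in> prime_factors n. p \<le> N}" and "B = {p \<in> prime_factors n. p > N}"
  have fin: "finite S" "finite B" by (simp_all add: S_def B_def)
  have un: "prime_factors n = S \<union> B" "S \<inter> B = {}" by (auto simp: S_def B_def)
  have gt1: "p > 1" if "p \<in> prime_factors n" for p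
    using that prime_gt_1_nat by (auto simp: in_prime_factors_iff)
  \<comment> \<open>The sixth power of 2.72 is below 405, hence below 500.\<close>
  have "6 \<le> ln L"
  proof -
    have "exp (6::real) = exp 1 ^ 6" by (simp flip: exp_of_nat_mult)
    also have "\<dots> \<le> (272 / 100) ^ 6" using e_less_272 by (intro power_mono) auto
    also have "\<dots> \<le> L" using L by (simp add: power_divide)
    finally show ?thesis using L by (simp add: ln_ge_iff)
  qed
  \<comment> \<open>Each \<open>p\<close> in \<open>B\<close> is at least \<open>N + 1 > L\<close>,
    so it takes up at least \<open>ln L\<close> of the total \<open>L\<close>.\<close>
  have "real (card B) * ln L = (\<Sum>p\<in>B. ln L)" by simp
  also have "\<dots> \<le> (\<Sum>p\<in>B. ln (real p))"
    using N L by (intro sum_mono) (auto simp: B_def)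
  also have "\<dots> \<le> (\<Sum>p\<in>prime_factors n. ln (real p))"
    using gt1 by (intro sum_mono2) (auto simp: B_def less_imp_le)
  also have "\<dots> \<le> L" unfolding L_def using n by (rule sum_ln_prime_factors_le)
  finally have "real (card B) * 6 \<le> L"
    using mult_left_mono[OF \<open>6 \<le> ln L\<close>, of "real (card B)"] by simp
  \<comment> \<open>Since \<open>L < N + 1\<close> and \<open>N \<ge> 500\<close>, the ratio is at
    most \<open>501 / 3000\<close>.\<close>
  then have card: "real (card B) / real N \<le> 17 / 100" using N by (simp add: field_simps)
  have "(\<Sum>p\<in>S. ln (real p / (real p - 1))) \<le> ln_euler_prod_odd N"
    unfolding ln_euler_prod_odd_def
  proof (intro sum_mono2 finite_odd_primes_le)
    show "S \<subseteq> {p. prime p \<and> odd p \<and> p \<le> N}"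
      using assms(1) by (auto simp: S_def in_prime_factors_iff)
    show "0 \<le> ln (real p / (real p - 1))" if "p \<in> {p. prime p \<and> odd p \<and> p \<le> N} - S" for p
      using that prime_gt_1_nat[of p] by (intro ln_ge_zero) auto
  qed
  also have "\<dots> \<le> ln (ln (real N)) + 2 / 5" using N by (intro ln_euler_prod_odd_le) simp
  also have "ln (ln (real N)) \<le> ln (ln L)"
  proof -
    have "1 < real N" using N by linarith
    then have "0 < ln (real N)" "ln (real N) \<le> ln L" using N by auto
    then show ?thesis by simp
  qed
  finally have small: "(\<Sum>p\<in>S. ln (real p / (real p - 1))) \<le> ln (ln L) + 2 / 5" by simp
  have "(\<Sum>p\<in>B. ln (real p / (real p - 1))) \<le> (\<Sum>p\<in>B. 1 / real N)"
  proof (intro sum_mono)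
    fix p assume "p \<in> B"
    then have p: "real p \<ge> real N + 1" by (auto simp: B_def)
    have "ln (real p / (real p - 1)) \<le> real p / (real p - 1) - 1"
      using p N by (intro ln_le_minus_one) simp
    also have "\<dots> \<le> 1 / real N" using p N by (simp add: field_simps)
    finally show "ln (real p / (real p - 1)) \<le> 1 / real N" .
  qed
  also have "\<dots> = real (card B) / real N" by simp
  finally have "(\<Sum>p\<in>B. ln (real p / (real p - 1))) \<le> 17 / 100" using card by linarith
  then show ?thesis using small un fin by (simp add: sum.union_disjoint L_def)
qed

lemma robin_criterion_if_odd:
  assumes "odd n" "ln (real n) \<ge> 500"
  shows "robin_criterion n"
proof -
  have n: "n > 0" using assms(1) by (rule odd_pos)
  have gt1: "p > 1" if "p \<in> prime_factors n" for p
    using that prime_gt_1_nat by (auto simp: in_prime_factors_iff)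
  have "(\<Prod>p\<in>prime_factors n. real p / (real p - 1))
      = exp (\<Sum>p\<in>prime_factors n. ln (real p / (real p - 1)))"
    unfolding exp_sum[OF finite_set_mset] using gt1 by (intro prod.cong) force+
  \<comment> \<open>The whole estimate is tuned to this comparison:
    \<open>57 / 100 < 19 / 33 < euler_mascheroni\<close>. Strictness also comes from here.\<close>
  also have "\<dots> < exp (ln (ln (ln (real n))) + euler_mascheroni)"
    using sum_ln_prime_factors_euler_le[OF assms] euler_mascheroni_gt_19_over_33 by simp
  also have "\<dots> = exp euler_mascheroni * ln (ln (real n))"
  proof -
    have "ln (ln (real n)) > 0" using assms(2) by simp
    then show ?thesis by (simp add: exp_add)
  qed
  finally have "real n * (\<Prod>p\<in>prime_factors n. real p / (real p - 1))
      < real n * (exp euler_mascheroni * ln (ln (real n)))"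
    using n by simp
  then show ?thesis
    using divisor_sigma_le[OF n] by (simp add: robin_criterion_def mult_ac)
qed

section \<open>From Robin's inequality to Lagarias's\<close>

text \<open>The sequence \<open>harm n - ln n\<close> decreases to its limit
  \<open>euler_mascheroni\<close>.\<close>

lemma harm_ge_ln_plus_euler_mascheroni:
  assumes "n > 0"
  shows "harm n \<ge> ln (real n) + euler_mascheroni"
proof -
  have "euler_mascheroni \<le> harm n - ln (real n)"
    using euler_mascheroni_LIMSEQ
    by (rule LIMSEQ_le_const2) (use assms euler_mascheroni_sequence_decreasing in auto)
  then show ?thesis by simp
qed

lemma lagarias_criterion_if_robin:
  assumes "robin_criterion n" "ln (real n) \<ge> 1"
  shows "lagarias_criterion n"
proof -
  have n: "n > 0" using assms(2) by (intro gr0I) auto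
  have harm: "ln (real n) + euler_mascheroni \<le> harm n"
    using n by (rule harm_ge_ln_plus_euler_mascheroni)
  have "exp euler_mascheroni * real n = exp (ln (real n) + euler_mascheroni)"
    using n by (simp add: exp_add)
  also have "\<dots> \<le> exp (harm n)" using harm by simp
  finally have "exp euler_mascheroni * real n \<le> exp (harm n)" .
  moreover have "ln (ln (real n)) \<le> ln (harm n)"
    using assms(2) harm euler_mascheroni_pos by (subst ln_le_cancel_iff) linarith+
  \<comment> \<open>The factors are compared separately; \<open>ln n \<ge> 1\<close> makes
    \<open>ln (ln n)\<close> nonnegative, as this requires.\<close>
  ultimately have "exp euler_mascheroni * real n * ln (ln (real n)) \<le> exp (harm n) * ln (harm n)"
    using assms(2) by (intro mult_mono) auto
  moreover have "(harm n :: real) \<ge> 0" by (rule harm_nonneg)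
  ultimately show ?thesis
    using assms(1) by (simp add: robin_criterion_def lagarias_criterion_def)
qed

section \<open>Size of the primorial and conclusion\<close>

text \<open>Trial division as a gcd test: in \<open>p = d * e\<close> one factor is at most
  \<open>m\<close>, so it divides \<open>fact m\<close> and must be 1.\<close>

lemma prime_if_coprime_fact:
  fixes p m :: nat
  assumes "1 < p" "p < (m + 1)\<^sup>2" "coprime p (fact m)"
  shows "prime p"
  unfolding prime_nat_iff
proof (intro conjI allI impI)
  fix d assume "d dvd p"
  then obtain e where e: "p = d * e" by (rule dvdE)
  have small: "x = 1" if "x dvd p" "x \<le> m" for x
  proof -
    have "x > 0" using that(1) assms(1) by (auto intro: gr0I)
    then have "x dvd fact m" using that(2) by (intro dvd_fact) auto
    then show ?thesis using that(1) assms(3) coprime_common_divisor_nat by blast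
  qed
  have "d \<le> m \<or> e \<le> m"
    using assms(2) mult_le_mono[of "m + 1" d "m + 1" e] unfolding e power2_eq_square by linarith
  then have "d = 1 \<or> e = 1" using small[of d] small[of e] e by auto
  then show "d = 1 \<or> d = p" using e by auto
qed (rule assms(1))

lemma odd_primorial_331_ge: "10 ^ 120 \<le> odd_primorial_331"
proof -
  \<comment> \<open>The odd primes below 19 are left out so that every entry is coprime to
    \<open>fact 18\<close>; this costs only a factor 255255.\<close>
  define ps :: "nat list" where "ps = [19, 23, 29, 31, 37, 41, 43, 47, 53, 59,
    61, 67, 71, 73, 79, 83, 89, 97, 101, 103, 107, 109, 113, 127, 131, 137, 139, 149, 151, 157,
    163, 167, 173, 179, 181, 191, 193, 197, 199, 211, 223, 227, 229, 233, 239, 241, 251, 257, 263,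
    269, 271, 277, 281, 283, 293, 307, 311, 313, 317, 331]"
  have range: "list_all (\<lambda>p. odd p \<and> 3 \<le> p \<and> p \<le> 331) ps" by (simp add: ps_def)
  have coprime: "list_all (\<lambda>p. coprime p 510510) ps"
    by (simp add: ps_def coprime_iff_gcd_eq_1 gcd_non_0_nat)
  \<comment> \<open>510510 is the product of the primes below 19; gcds with it are cheaper than with \<^term>\<open>fact 18\<close>.\<close>
  have fact: "fact 18 dvd (510510 :: nat) ^ 16" by (simp add: fact_numeral)
  have sub: "set ps \<subseteq> {p. prime p \<and> odd p \<and> 3 \<le> p \<and> p \<le> 331}"
  proof
    fix p assume p: "p \<in> set ps"
    then have "odd p" "3 \<le> p" "p \<le> 331" using range by (auto simp: list_all_iff)
    moreover have "prime p"
    \<comment> \<open>Here \<open>m = 18\<close>, as \<open>19 ^ 2 = 361\<close> exceeds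
      331.\<close>
    proof (rule prime_if_coprime_fact)
      have "coprime p 510510" using p coprime by (simp add: list_all_iff)
      \<comment> \<open>The exponent 16 is that of 2 in \<open>fact 18\<close>, the largest in its
        factorization.\<close>
      then have "coprime p (510510 ^ 16)" by (simp only: coprime_power_right_iff simp_thms)
      then show "coprime p (fact 18)" using fact by (rule coprime_divisors[OF dvd_refl, rotated])
    qed (use \<open>3 \<le> p\<close> \<open>p \<le> 331\<close> in auto)
    ultimately show "p \<in> {p. prime p \<and> odd p \<and> 3 \<le> p \<and> p \<le> 331}" by simp
  qed
  have "distinct ps" by (simp add: ps_def)
  then have "prod_list ps = \<Prod>(set ps)" by (simp add: prod.distinct_set_conv_list)
  also have "\<dots> \<le> odd_primorial_331"
    unfolding odd_primorial_331_def
  proof (rule dvd_imp_le[OF prod_dvd_prod_subset[OF _ sub]])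
    show "finite {p::nat. prime p \<and> odd p \<and> 3 \<le> p \<and> p \<le> 331}"
      by (rule finite_subset[of _ "{..331}"]) auto
    show "0 < \<Prod>{p::nat. prime p \<and> odd p \<and> 3 \<le> p \<and> p \<le> 331}"
      by (rule prod_pos) simp
  qed
  finally have "prod_list ps \<le> odd_primorial_331" .
  moreover have "10 ^ 120 \<le> prod_list ps" by (simp add: ps_def)
  ultimately show ?thesis by (rule le_trans[rotated])
qed

theorem theorem3:
  fixes n :: nat
  assumes "odd n" and "n > 2 * odd_primorial_331 ^ 2"
  shows "lagarias_criterion n \<and> robin_criterion n"
proof -
  \<comment> \<open>With \<open>exp 1 \<le> 3\<close>, the bound \<open>ln n \<ge> 500\<close>
    follows from this comparison of integers; \<open>3 ^ 500\<close> is below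
    \<open>10 ^ 239\<close>.\<close>
  have "(3::nat) ^ 500 \<le> 2 * (10 ^ 120) ^ 2" by simp
  also have "\<dots> \<le> 2 * odd_primorial_331 ^ 2"
    using odd_primorial_331_ge by (intro mult_left_mono power_mono) auto
  also have "\<dots> \<le> n" using assms(2) by simp
  finally have n: "real (3 ^ 500) \<le> real n" by (simp only: of_nat_le_iff)
  have "exp (500::real) = exp 1 ^ 500" by (simp flip: exp_of_nat_mult)
  also have "\<dots> \<le> 3 ^ 500" using exp_le by (intro power_mono) auto
  also have "\<dots> \<le> real n" using n by simp
  finally have "ln (real n) \<ge> 500"
    using odd_pos[OF assms(1)] by (simp add: ln_ge_iff)
  with assms(1) show ?thesis
    using robin_criterion_if_odd lagarias_criterion_if_robin by auto
qed

end
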